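(* Let $\mathrm{H}:\mathbf{Top}_0\to\mathbf{Set}$ be an R-subset system, and let $X$ and $Y$ be $T_0$ spaces. Let $\mathbb{C}(X,Y)$ be the set of all continuous functions from $X$ to $Y$. (1) If $\mathbb{C}(X,Y)$ equipped with the compact-open topology is $\mathrm{H}$-sober, then $Y$ is $\mathrm{H}$-sober. (2) If $\mathbb{C}(X,Y)$ equipped with the pointwise convergence topology is $\mathrm{H}$-sober, then $Y$ is $\mathrm{H}$-sober.
   Context: $\mathbf{Top}_0$ is the category of $T_0$ spaces and continuous maps; $\mathbf{Set}$ is the category of sets and maps. For a $T_0$ space $X$, a nonempty subset $A\subseteq X$ is irreducible if for any closed sets $F_1,F_2$, $A\subseteq F_1\cup F_2$ implies $A\subseteq F_1$ or $A\subseteq F_2$; $\mathsf{Irr}(X)$ is the set of all irreducible subsets of $X$. An R-subset system (irreducible subset system) is a covariant functor $\mathrm{H}:\mathbf{Top}_0\to\mathbf{Set}$ such that (i) for each $T_0$ space $X$, $\{\{x\}:x\in X\}\subseteq \mathrm{H}(X)\subseteq \mathsf{Irr}(X)$; (ii) for each continuous map $f:X\to Y$ of $T_0$ spaces and each $A\in\mathrm{H}(X)$, $\mathrm{H}(f)(A)=f(A)\in \mathrm{H}(Y)$. A $T_0$ space $X$ is $\mathrm{H}$-sober if for every $A\in\mathrm{H}(X)$ there is a (necessarily unique) point $x\in X$ with $\overline{A}=\overline{\{x\}}$. The compact-open topology on $\mathbb{C}(X,Y)$ is generated (as a subbasis) by the sets $N(K\rightarrow V)=\{f\in\mathbb{C}(X,Y):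 f(K)\subseteq V\}$, with $K$ compact in $X$ and $V$ open in $Y$ (no Hausdorff assumption). The pointwise convergence topology has as a subbasis the sets $S(x,U)=\{f\in\mathbb{C}(X,Y): f(x)\in U\}$, with $x\in X$ and $U$ open in $Y$.
   Formalization: The space X is assumed nonempty: for X empty, C(X,Y) is a single point and so H-sober, while Y need not be H-sober (e.g. H = Irr and Y an infinite set with the cofinite topology). *)

theory Defs
  imports "HOL-Analysis.Analysis"
begin

definition irreducible_in :: "'a topology \<Rightarrow> 'a set \<Rightarrow> bool" where
  "irreducible_in X A \<longleftrightarrow> A \<noteq> {} \<and> A \<subseteq> topspace X \<and>
     (\<forall>F1 F2. closedin X F1 \<longrightarrow> closedin X F2 \<longrightarrow> A \<subseteq> F1 \<union> F2 \<longrightarrow> A \<subseteq> F1 \<or> A \<subseteq> F2)"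

definition Irr :: "'a topology \<Rightarrow> 'a set set" where
  "Irr X = {A. irreducible_in X A}"

text \<open>
  An R-subset system is a functor H on all T0 spaces.  HOL cannot quantify over types inside a
  formula, so H appears as a family with one component
  \<open>H\<^sub>a :: 'a topology \<Rightarrow> 'a set set\<close> for each type of points; its action on a morphism f is the image
  map \<open>A \<mapsto> f ` A\<close>, so preservation of identities and composition is automatic.  All requirements
  on the family involve at most two types at a time: \<open>R_subset_system H K\<close> says that H and K are
  the components, at the types \<open>'a\<close> and \<open>'b\<close>, of one such functor, restricted to the T0 spaces
  whose points belong to one of these two types.  Values on spaces that are not T0 are irrelevant.
\<close>

definition subset_system_bounds :: "('a topology \<Rightarrow> 'a set set) \<Rightarrow> bool" where
  "subset_system_bounds H \<longleftrightarrow>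
     (\<forall>X. t0_space X \<longrightarrow> {{x} | x. x \<in> topspace X} \<subseteq> H X \<and> H X \<subseteq> Irr X)"

definition image_functorial ::
    "('a topology \<Rightarrow> 'a set set) \<Rightarrow> ('b topology \<Rightarrow> 'b set set) \<Rightarrow> bool" where
  "image_functorial H K \<longleftrightarrow>
     (\<forall>X Y f. t0_space X \<longrightarrow> t0_space Y \<longrightarrow> continuous_map X Y f \<longrightarrow> (\<forall>A \<in> H X. f ` A \<in> K Y))"

definition R_subset_system ::
    "('a topology \<Rightarrow> 'a set set) \<Rightarrow> ('b topology \<Rightarrow> 'b set set) \<Rightarrow> bool" where
  "R_subset_system H K \<longleftrightarrow>
     subset_system_bounds H \<and> subset_system_bounds K \<and>
     image_functorial H H \<and> image_functorial H K \<and>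
     image_functorial K H \<and> image_functorial K K"

definition H_sober :: "('a topology \<Rightarrow> 'a set set) \<Rightarrow> 'a topology \<Rightarrow> bool" where
  "H_sober H X \<longleftrightarrow> t0_space X \<and>
     (\<forall>A \<in> H X. \<exists>x \<in> topspace X. X closure_of A = X closure_of {x})"

text \<open>
  A continuous map is represented by the function that is \<open>undefined\<close> outside \<open>topspace X\<close>, so that
  distinct elements of \<open>cont_maps X Y\<close> are distinct maps on X.
\<close>

definition cont_maps :: "'a topology \<Rightarrow> 'b topology \<Rightarrow> ('a \<Rightarrow> 'b) set" where
  "cont_maps X Y = {f \<in> extensional (topspace X). continuous_map X Y f}"

text \<open>
  The topologies on \<open>cont_maps X Y\<close> generated by a subbasis; as in the definition of the product
  topology, \<open>relative_to\<close> makes the empty intersection equal to the whole set.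
\<close>

definition compact_open_topology :: "'a topology \<Rightarrow> 'b topology \<Rightarrow> ('a \<Rightarrow> 'b) topology" where
  "compact_open_topology X Y = topology (arbitrary union_of
     (finite intersection_of
        (\<lambda>N. \<exists>K V. compactin X K \<and> openin Y V \<and> N = {f \<in> cont_maps X Y. f ` K \<subseteq> V})
      relative_to cont_maps X Y))"

definition pointwise_topology :: "'a topology \<Rightarrow> 'b topology \<Rightarrow> ('a \<Rightarrow> 'b) topology" where
  "pointwise_topology X Y = topology (arbitrary union_of
     (finite intersection_of
        (\<lambda>S. \<exists>x U. x \<in> topspace X \<and> openin Y U \<and> S = {f \<in> cont_maps X Y. f x \<in> U})
      relative_to cont_maps X Y))"

end

theory Submission
  imports Defs
begin

text \<open>
  Since \<open>topspace X\<close> contains a point \<open>x0\<close>, the constant maps embed \<open>Y\<close> in either function space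
  and evaluation at \<open>x0\<close> is a continuous left inverse. So \<open>Y\<close> is a retract of the function space,
  and sobriety passes to retracts: push \<open>A\<close> into the big space, take the generic point of its
  image there, and map that point back.
\<close>

lemma H_sober_retraction_maps:
  assumes RS: "R_subset_system H K" and "t0_space Y" and sober: "H_sober K C"
    and ret: "retraction_maps C Y r s"
  shows "H_sober H Y"
  unfolding H_sober_def
proof (intro conjI ballI)
  show "t0_space Y" by fact
next
  fix A assume A: "A \<in> H Y"
  have r: "continuous_map C Y r" and s: "continuous_map Y C s"
    and rs: "\<And>y. y \<in> topspace Y \<Longrightarrow> r (s y) = y"
    using ret by (auto simp: retraction_maps_def)
  have "subset_system_bounds H" and HK: "image_functorial H K"
    using RS by (simp_all add: R_subset_system_def)
  then have "H Y \<subseteq> Irr Y"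
    using \<open>t0_space Y\<close> by (simp add: subset_system_bounds_def)
  with A have "A \<in> Irr Y" ..
  then have AY: "A \<subseteq> topspace Y"
    by (simp add: Irr_def irreducible_in_def)
  have "t0_space C"
    using sober by (simp add: H_sober_def)
  with HK have "s ` A \<in> K C"
    using A \<open>t0_space Y\<close> s by (simp add: image_functorial_def)
  then obtain f where f: "f \<in> topspace C" and eq: "C closure_of (s ` A) = C closure_of {f}"
    using sober unfolding H_sober_def by blast
  have rf: "r f \<in> topspace Y"
    using f r by (auto simp: continuous_map_def)
  have "r f \<in> r ` (C closure_of (s ` A))"
    using f eq closure_of_subset[of "{f}" C] by auto
  moreover have "r ` (C closure_of (s ` A)) \<subseteq> Y closure_of (r ` s ` A)"
    using r by (rule continuous_map_image_closure_subset)
  moreover have rsA: "r ` s ` A = A"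
    using AY rs by (force simp: image_image)
  ultimately have "{r f} \<subseteq> Y closure_of A" by auto
  then have 1: "Y closure_of {r f} \<subseteq> Y closure_of A"
    by (simp add: closure_of_minimal)
  have "s ` A \<subseteq> C closure_of {f}"
    using AY s closure_of_subset[of "s ` A" C] eq by (auto simp: continuous_map_def)
  then have "r ` s ` A \<subseteq> Y closure_of (r ` {f})"
    using continuous_map_image_closure_subset[OF r, of "{f}"] by blast
  then have "A \<subseteq> Y closure_of {r f}"
    using rsA by simp
  then have "Y closure_of A \<subseteq> Y closure_of {r f}"
    by (simp add: closure_of_minimal)
  with 1 rf show "\<exists>y\<in>topspace Y. Y closure_of A = Y closure_of {y}" by blast
qed

lemma const_in_cont_maps:
  assumes "y \<in> topspace Y"
  shows "(\<lambda>x\<in>topspace X. y) \<in> cont_maps X Y"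
proof -
  have "continuous_map X Y (\<lambda>x. y)"
    using assms by simp
  then have "continuous_map X Y (\<lambda>x\<in>topspace X. y)"
    by (rule continuous_map_eq) simp
  then show ?thesis
    by (simp add: cont_maps_def)
qed

text \<open>\<open>relative_to\<close> intersects with \<open>S\<close>, which leaves
  \<open>N\<close> unchanged because \<open>N \<subseteq> S\<close>.\<close>

lemma openin_subbase_element:
  assumes T: "T = topology (arbitrary union_of (finite intersection_of P relative_to S))"
    and "P N" and "N \<subseteq> S"
  shows "openin T N"
proof -
  have "(finite intersection_of P relative_to S) N"
    using assms(2,3) by (intro relative_to_subset_inc finite_intersection_of_inc)
  then show ?thesis
    unfolding T openin_subbase by (rule arbitrary_union_of_inc)
qed

text \<open>Shared by both topologies, which differ only in the subbasis \<open>P\<close>. By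
  \<open>eval\<close>, preimages of open sets under evaluation at \<open>x0\<close> are subbasic, so
  evaluation is continuous. Continuity of the embedding by constants need only be tested on subbasic
  sets, which is \<open>const\<close>.\<close>

lemma retraction_maps_const_eval:
  assumes T: "T = topology (arbitrary union_of (finite intersection_of P relative_to cont_maps X Y))"
    and x0: "x0 \<in> topspace X"
    and eval: "\<And>U. openin Y U \<Longrightarrow> P {f \<in> cont_maps X Y. f x0 \<in> U}"
    and const: "\<And>N. P N \<Longrightarrow> openin Y {y \<in> topspace Y. (\<lambda>x\<in>topspace X. y) \<in> N}"
  shows "retraction_maps T Y (\<lambda>f. f x0) (\<lambda>y. \<lambda>x\<in>topspace X. y)"
proof -
  have top: "topspace T = cont_maps X Y"
    by (simp add: T)
  have "continuous_map Y T (\<lambda>y. \<lambda>x\<in>topspace X. y)"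
    unfolding T
    by (rule continuous_map_into_topology_subbase) (use const_in_cont_maps const in auto)
  moreover have "continuous_map T Y (\<lambda>f. f x0)"
    unfolding continuous_map_def
  proof (intro conjI allI impI)
    show "(\<lambda>f. f x0) \<in> topspace T \<rightarrow> topspace Y"
      using x0 by (auto simp: top cont_maps_def continuous_map_def)
    show "openin T {f \<in> topspace T. f x0 \<in> U}" if "openin Y U" for U
      using openin_subbase_element[OF T eval[OF that]] by (simp add: top)
  qed
  ultimately show ?thesis
    using x0 by (simp add: retraction_maps_def)
qed

lemma retraction_maps_compact_open_topology:
  assumes "x0 \<in> topspace X"
  shows "retraction_maps (compact_open_topology X Y) Y (\<lambda>f. f x0) (\<lambda>y. \<lambda>x\<in>topspace X. y)"
proof (rule retraction_maps_const_eval[OF compact_open_topology_def assms], goal_cases)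
  case (1 U)
  then show ?case
    \<comment> \<open>Singletons are compact, so a condition at the point \<open>x0\<close> is a
      compact-open condition on \<open>{x0}\<close>.\<close>
    using assms by (intro exI[of _ "{x0}"] exI[of _ U]) simp
next
  case (2 N)
  then obtain K V where K: "compactin X K" and V: "openin Y V"
    and N: "N = {f \<in> cont_maps X Y. f ` K \<subseteq> V}" by blast
  \<comment> \<open>A constant map sends a nonempty \<open>K\<close> onto \<open>{y}\<close>, so the
    condition becomes \<open>y \<in> V\<close>; for empty \<open>K\<close> it holds for every
    \<open>y\<close>.\<close>
  have "{y \<in> topspace Y. (\<lambda>x\<in>topspace X. y) \<in> N} = (if K = {} then topspace Y else V)"
    using compactin_subset_topspace[OF K] openin_subset[OF V]
    by (auto simp: N const_in_cont_maps)
  then show ?case using V by simp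
qed

lemma retraction_maps_pointwise_topology:
  assumes "x0 \<in> topspace X"
  shows "retraction_maps (pointwise_topology X Y) Y (\<lambda>f. f x0) (\<lambda>y. \<lambda>x\<in>topspace X. y)"
proof (rule retraction_maps_const_eval[OF pointwise_topology_def assms], goal_cases)
  case (1 U)
  then show ?case using assms by blast
next
  case (2 N)
  then obtain x U where x: "x \<in> topspace X" and U: "openin Y U"
    and N: "N = {f \<in> cont_maps X Y. f x \<in> U}" by blast
  have "{y \<in> topspace Y. (\<lambda>x\<in>topspace X. y) \<in> N} = U"
    using x openin_subset[OF U]
    by (auto simp: N const_in_cont_maps)
  then show ?case using U by simp
qed

theorem proposition4p10:
  fixes X :: "'a topology" and Y :: "'b topology"
    and H :: "'b topology \<Rightarrow> 'b set set"
    and H' :: "('a \<Rightarrow> 'b) topology \<Rightarrow> ('a \<Rightarrow> 'b) set set"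
  assumes "R_subset_system H H'"
    and "t0_space X" and "t0_space Y"
    and "topspace X \<noteq> {}"
  shows "(H_sober H' (compact_open_topology X Y) \<longrightarrow> H_sober H Y) \<and>
         (H_sober H' (pointwise_topology X Y) \<longrightarrow> H_sober H Y)"
proof -
  \<comment> \<open>Evaluation needs a base point. Over an empty \<open>X\<close> either function
    space is a single point, hence sober whatever \<open>Y\<close> is.\<close>
  obtain x0 where "x0 \<in> topspace X"
    using assms(4) by blast
  then show ?thesis
    using H_sober_retraction_maps[OF assms(1,3) _ retraction_maps_compact_open_topology]
      H_sober_retraction_maps[OF assms(1,3) _ retraction_maps_pointwise_topology] by simp
qed

end
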